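(* Let $h\in\Bbbk[x]\setminus\Bbbk$. For every $\Bbbk$-derivation $D$ of $A_h$, the following conditions are equivalent: (i) $D$ is locally nilpotent; (ii) $\mathrm{Aut}_D(A_h)$ contains automorphisms of arbitrarily large degree, i.e. for every integer $d\ge 1$ there is $\rho\in\mathrm{Aut}_D(A_h)$ with $\deg(\rho)\ge d$.
   Context: $\Bbbk$ is an algebraically closed field of characteristic zero. For $h\in\Bbbk[x]$, $A_h=\Bbbk[x][t;h(x)\partial_x]$ is the differential Ore extension, i.e. the associative unital $\Bbbk$-algebra generated by $x,t$ subject to $tx-xt=h(x)$; every element $u\in A_h$ is written uniquely as a finite sum $u=\sum_{i,j\ge0}c_{ij}x^it^j$ with $c_{ij}\in\Bbbk$. The total degree is $\deg(u)=\max\{i+j\mid c_{ij}\ne0\}$, with $\deg(0)=-\infty$. For a $\Bbbk$-algebra automorphism $\rho$ of $A_h$, $\deg(\rho)=\max\{\deg(\rho(x)),\deg(\rho(t))\}$. For a $\Bbbk$-derivation $D$ of a $\Bbbk$-algebra $A$, the isotropy group is $\mathrm{Aut}_D(A)=\{\rho\in\mathrm{Aut}(A)\mid\rho D=D\rho\}$, where $\mathrm{Aut}(A)$ is the group of $\Bbbk$-algebra automorphisms; $D$ is locally nilpotent if for every $a\in A$ there is $n\ge1$ with $D^n(a)=0$. *)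

theory Defs
  imports
    "HOL-Computational_Algebra.Polynomial"
    "HOL-Library.Extended_Real"
    "HOL-Algebra.QuotRing"
begin

text \<open>
  An element of \<open>A\<^sub>h = k[x][t; h \<partial>\<^sub>x]\<close> is represented by its normal form
  \<open>\<Sum>\<^sub>j a\<^sub>j(x) t\<^sup>j\<close>, coefficients on the left. This is a polynomial in \<open>t\<close> over \<open>k[x]\<close>, so the
  additive structure is that of \<open>k poly poly\<close>. The commutative product of that type is not the
  product of \<open>A\<^sub>h\<close>, which is \<open>ore_mult h\<close> below.
\<close>

definition ore_deriv :: "'k::field poly \<Rightarrow> 'k poly \<Rightarrow> 'k poly" where
  "ore_deriv h a = h * pderiv a"

text \<open>
  Left multiplication by \<open>t\<close>: since \<open>t a = a t + h a'\<close> for \<open>a \<in> k[x]\<close>, we have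
  \<open>t (\<Sum>\<^sub>j b\<^sub>j t\<^sup>j) = \<Sum>\<^sub>j b\<^sub>j t\<^sup>j\<^sup>+\<^sup>1 + \<Sum>\<^sub>j (h b\<^sub>j') t\<^sup>j\<close>.
\<close>

definition ore_tmult :: "'k::field poly \<Rightarrow> 'k poly poly \<Rightarrow> 'k poly poly" where
  "ore_tmult h v = pCons 0 v + map_poly (ore_deriv h) v"

definition ore_mult :: "'k::field poly \<Rightarrow> 'k poly poly \<Rightarrow> 'k poly poly \<Rightarrow> 'k poly poly" where
  "ore_mult h u v = (\<Sum>j\<le>degree u. smult (coeff u j) ((ore_tmult h ^^ j) v))"

definition ore_ext :: "'k::field poly \<Rightarrow> 'k poly poly ring" where
  "ore_ext h = \<lparr>carrier = UNIV, mult = ore_mult h, one = 1, zero = 0, add = (+)\<rparr>"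

definition ore_scale :: "'k::field \<Rightarrow> 'k poly poly \<Rightarrow> 'k poly poly" where
  "ore_scale c u = smult [:c:] u"

definition ore_x :: "'k::field poly poly" where
  "ore_x = [:[:0, 1:]:]"

definition ore_t :: "'k::field poly poly" where
  "ore_t = [:0, 1:]"

text \<open>Here \<open>coeff (coeff u j) i\<close> is the coefficient \<open>c\<^sub>i\<^sub>j\<close> of \<open>x\<^sup>i t\<^sup>j\<close>.\<close>

definition total_deg :: "'k::field poly poly \<Rightarrow> ereal" where
  "total_deg u =
     (if u = 0 then -\<infinity>
      else ereal (real (Max {i + j |i j. coeff (coeff u j) i \<noteq> 0})))"

definition ore_Aut :: "'k::field poly \<Rightarrow> ('k poly poly \<Rightarrow> 'k poly poly) set" where
  "ore_Aut h = {\<rho> \<in> ring_iso (ore_ext h) (ore_ext h). Vector_Spaces.linear ore_scale ore_scale \<rho>}"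

definition aut_deg :: "('k::field poly poly \<Rightarrow> 'k poly poly) \<Rightarrow> ereal" where
  "aut_deg \<rho> = max (total_deg (\<rho> ore_x)) (total_deg (\<rho> ore_t))"

definition ore_derivation :: "'k::field poly \<Rightarrow> ('k poly poly \<Rightarrow> 'k poly poly) \<Rightarrow> bool" where
  "ore_derivation h D \<longleftrightarrow>
     Vector_Spaces.linear ore_scale ore_scale D \<and>
     (\<forall>u v. D (ore_mult h u v) = ore_mult h (D u) v + ore_mult h u (D v))"

definition isotropy_group ::
  "'k::field poly \<Rightarrow> ('k poly poly \<Rightarrow> 'k poly poly) \<Rightarrow> ('k poly poly \<Rightarrow> 'k poly poly) set" where
  "isotropy_group h D = {\<rho> \<in> ore_Aut h. \<rho> \<circ> D = D \<circ> \<rho>}"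

definition locally_nilpotent :: "('k::field poly poly \<Rightarrow> 'k poly poly) \<Rightarrow> bool" where
  "locally_nilpotent D \<longleftrightarrow> (\<forall>u. \<exists>n\<ge>1. (D ^^ n) u = 0)"


text \<open>
  The multiplication makes \<open>k poly poly\<close> a unital \<open>k\<close>-algebra with \<open>t x - x t = h\<close> in which
  \<open>c x\<^sup>i t\<^sup>j\<close> is \<open>monom (monom c i) j\<close>.
\<close>

lemma ore_deriv_0 [simp]: "ore_deriv h 0 = 0"
  by (simp add: ore_deriv_def)

lemma ore_deriv_add: "ore_deriv h (a + b) = ore_deriv h a + ore_deriv h b"
  by (simp add: ore_deriv_def pderiv_add algebra_simps)

lemma ore_deriv_mult: "ore_deriv h (a * b) = ore_deriv h a * b + a * ore_deriv h b"
  by (simp add: ore_deriv_def pderiv_mult algebra_simps)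

lemma coeff_ore_tmult:
  "coeff (ore_tmult h v) n = (case n of 0 \<Rightarrow> 0 | Suc m \<Rightarrow> coeff v m) + ore_deriv h (coeff v n)"
  by (simp add: ore_tmult_def coeff_map_poly coeff_pCons split: nat.split)

lemma ore_tmult_0 [simp]: "ore_tmult h 0 = 0"
  by (simp add: ore_tmult_def)

lemma ore_tmult_add: "ore_tmult h (u + v) = ore_tmult h u + ore_tmult h v"
  by (rule poly_eqI) (simp add: coeff_ore_tmult ore_deriv_add split: nat.split)

lemma ore_tmult_smult:
  "ore_tmult h (smult a v) = smult a (ore_tmult h v) + smult (ore_deriv h a) v"
  by (rule poly_eqI) (simp add: coeff_ore_tmult ore_deriv_mult algebra_simps split: nat.split)

lemma ore_tmult_sum: "ore_tmult h (sum f S) = (\<Sum>i\<in>S. ore_tmult h (f i))"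
  by (induction S rule: infinite_finite_induct) (simp_all add: ore_tmult_add)

lemma funpow_ore_tmult_add: "(ore_tmult h ^^ n) (u + v) = (ore_tmult h ^^ n) u + (ore_tmult h ^^ n) v"
  by (induction n) (simp_all add: ore_tmult_add)

lemma ore_mult_eq:
  assumes "degree u \<le> n"
  shows "ore_mult h u v = (\<Sum>j\<le>n. smult (coeff u j) ((ore_tmult h ^^ j) v))"
  unfolding ore_mult_def
  by (rule sum.mono_neutral_left) (use assms in \<open>auto simp: coeff_eq_0\<close>)

lemma ore_mult_add_left: "ore_mult h (u + u') v = ore_mult h u v + ore_mult h u' v"
proof -
  define n where "n = max (degree u) (degree u')"
  have "degree (u + u') \<le> n" "degree u \<le> n" "degree u' \<le> n"
    by (auto simp: n_def intro: degree_add_le)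
  then show ?thesis
    by (simp add: ore_mult_eq[where n = n] smult_add_left sum.distrib)
qed

lemma ore_mult_add_right: "ore_mult h u (v + v') = ore_mult h u v + ore_mult h u v'"
  by (simp add: ore_mult_def funpow_ore_tmult_add smult_add_right sum.distrib)

lemma ore_mult_0_left [simp]: "ore_mult h 0 v = 0"
  by (simp add: ore_mult_def)

lemma smult_sum_right: "smult a (sum f S) = (\<Sum>i\<in>S. smult a (f i))"
  by (induction S rule: infinite_finite_induct) (simp_all add: smult_add_right)

lemma ore_mult_smult_left: "ore_mult h (smult a u) v = smult a (ore_mult h u v)"
proof -
  have "ore_mult h (smult a u) v = (\<Sum>j\<le>degree u. smult (coeff (smult a u) j) ((ore_tmult h ^^ j) v))"
    by (rule ore_mult_eq) (rule degree_smult_le)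
  also have "\<dots> = smult a (ore_mult h u v)"
    by (simp add: ore_mult_def smult_sum_right)
  finally show ?thesis .
qed

lemma ore_mult_sum_left: "ore_mult h (sum f S) v = (\<Sum>i\<in>S. ore_mult h (f i) v)"
  by (induction S rule: infinite_finite_induct) (simp_all add: ore_mult_add_left)

lemma ore_mult_const_left [simp]: "ore_mult h [:a:] v = smult a v"
  by (simp add: ore_mult_def)

lemma ore_mult_1_left [simp]: "ore_mult h 1 v = v"
  using ore_mult_const_left[of h 1 v] by (simp flip: one_pCons)

lemma ore_mult_t_left: "ore_mult h ore_t v = ore_tmult h v"
  by (simp add: ore_mult_def ore_t_def)

lemma funpow_ore_tmult_monom: "(ore_tmult h ^^ j) (monom 1 n) = monom 1 (n + j)"
proof (induction j)
  case (Suc j)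
  have "ore_tmult h (monom 1 (n + j)) = monom 1 (n + Suc j)"
    by (rule poly_eqI) (auto simp: coeff_ore_tmult ore_deriv_def split: nat.split)
  with Suc show ?case by simp
qed simp

lemma ore_mult_1_right [simp]: "ore_mult h u 1 = u"
proof -
  have "(ore_tmult h ^^ j) 1 = monom 1 j" for j
    using funpow_ore_tmult_monom[of j h 0] by simp
  then show ?thesis
    by (simp add: ore_mult_def smult_monom poly_as_sum_of_monoms)
qed

lemma ore_mult_pCons_left:
  "ore_mult h (pCons a u) v = smult a v + ore_mult h u (ore_tmult h v)"
proof -
  have "ore_mult h (pCons a u) v
      = (\<Sum>j\<le>Suc (degree u). smult (coeff (pCons a u) j) ((ore_tmult h ^^ j) v))"
    by (rule ore_mult_eq) (rule degree_pCons_le)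
  also have "\<dots> = smult a v + ore_mult h u (ore_tmult h v)"
    by (subst sum.atMost_Suc_shift) (simp add: ore_mult_def funpow_Suc_right del: funpow.simps)
  finally show ?thesis .
qed

lemma ore_mult_tmult_left: "ore_mult h (ore_tmult h u) v = ore_tmult h (ore_mult h u v)"
proof (induction u arbitrary: v)
  case (pCons a u)
  have "ore_tmult h (pCons a u) = pCons 0 (smult a 1) + pCons (ore_deriv h a) (ore_tmult h u)"
    by (rule poly_eqI) (simp add: coeff_ore_tmult coeff_pCons split: nat.split)
  then show ?case
    by (simp add: ore_mult_add_left ore_mult_pCons_left ore_mult_smult_left pCons.IH
        ore_tmult_add ore_tmult_smult)
qed simp

lemma ore_mult_funpow_left:
  "ore_mult h ((ore_tmult h ^^ n) u) v = (ore_tmult h ^^ n) (ore_mult h u v)"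
  by (induction n) (simp_all add: ore_mult_tmult_left)

lemma ore_mult_assoc: "ore_mult h (ore_mult h u v) w = ore_mult h u (ore_mult h v w)"
proof -
  have "ore_mult h (ore_mult h u v) w
      = (\<Sum>j\<le>degree u. smult (coeff u j) ((ore_tmult h ^^ j) (ore_mult h v w)))"
    unfolding ore_mult_def[of h u v]
    by (simp add: ore_mult_sum_left ore_mult_smult_left ore_mult_funpow_left)
  then show ?thesis by (simp add: ore_mult_def)
qed

lemma ring_ore_ext: "ring (ore_ext h)"
proof (rule ringI)
  show "abelian_group (ore_ext h)"
  proof (rule abelian_groupI)
    fix u assume "u \<in> carrier (ore_ext h)"
    show "\<exists>v\<in>carrier (ore_ext h). v \<oplus>\<^bsub>ore_ext h\<^esub> u = \<zero>\<^bsub>ore_ext h\<^esub>"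
      by (rule bexI[of _ "- u"]) (simp_all add: ore_ext_def)
  qed (simp_all add: ore_ext_def add_ac)
  show "monoid (ore_ext h)"
    by (rule monoidI) (simp_all add: ore_ext_def ore_mult_assoc)
qed (simp_all add: ore_ext_def ore_mult_add_left ore_mult_add_right)

lemma vector_space_ore_scale: "vector_space (ore_scale :: 'k::field \<Rightarrow> _)"
proof
  fix a b :: 'k and u v :: "'k poly poly"
  show "ore_scale (a + b) u = ore_scale a u + ore_scale b u"
    using smult_add_left[of "[:a:]" "[:b:]" u] by (simp add: ore_scale_def)
qed (simp_all add: ore_scale_def smult_add_right mult.commute flip: one_pCons)

lemma ore_scale_mult_left: "ore_mult h (ore_scale c u) v = ore_scale c (ore_mult h u v)"
  by (simp add: ore_scale_def ore_mult_smult_left)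

lemma ore_scale_mult_right: "ore_mult h u (ore_scale c v) = ore_scale c (ore_mult h u v)"
proof -
  have "ore_tmult h (smult [:c:] w) = smult [:c:] (ore_tmult h w)" for w
    by (simp add: ore_tmult_smult ore_deriv_def pderiv_pCons)
  then have "(ore_tmult h ^^ j) (smult [:c:] v) = smult [:c:] ((ore_tmult h ^^ j) v)" for j
    by (induction j) simp_all
  then show ?thesis
    by (simp add: ore_mult_def ore_scale_def smult_sum_right mult.commute)
qed

lemma ore_commutation: "ore_mult h ore_t ore_x - ore_mult h ore_x ore_t = [:h:]"
proof -
  have "ore_tmult h [:[:0, 1:]:] = [:h, [:0, 1:]:]"
    by (rule poly_eqI)
      (simp add: coeff_ore_tmult ore_deriv_def pderiv_pCons coeff_pCons split: nat.split)
  then show ?thesis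
    by (simp add: ore_mult_t_left) (simp add: ore_x_def ore_t_def)
qed

lemma ore_x_pow: "ore_x [^]\<^bsub>ore_ext h\<^esub> (i::nat) = [:monom 1 i:]"
proof (induction i)
  case 0
  then show ?case by (simp add: nat_pow_def ore_ext_def one_pCons)
next
  case (Suc i)
  then show ?case
    by (simp add: nat_pow_def ore_ext_def ore_x_def mult.commute monom_Suc)
qed

lemma ore_t_pow: "ore_t [^]\<^bsub>ore_ext h\<^esub> (j::nat) = monom 1 j"
proof (induction j)
  case 0
  then show ?case by (simp add: nat_pow_def ore_ext_def)
next
  case (Suc j)
  have t: "ore_t = monom 1 1"
    by (simp add: ore_t_def monom_altdef)
  from Suc show ?case
    by (simp add: nat_pow_def ore_ext_def ore_mult_def degree_monom_eq t
        funpow_ore_tmult_monom[of _ h 1, simplified] if_distrib[of "\<lambda>a. smult a _"] cong: if_cong)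
qed

lemma ore_monomial:
  "ore_scale c (ore_x [^]\<^bsub>ore_ext h\<^esub> (i::nat) \<otimes>\<^bsub>ore_ext h\<^esub> ore_t [^]\<^bsub>ore_ext h\<^esub> (j::nat))
   = monom (monom c i) j"
  unfolding ore_x_pow ore_t_pow
  by (simp add: ore_ext_def ore_scale_def smult_monom)

end

theory Submission
  imports Defs
begin

text \<open>
  Both conditions turn out to be equivalent to \<open>D\<close> having the form \<open>D x = 0\<close>, \<open>D t = g(x)\<close>. Write
  \<open>n > 0\<close> for the degree of \<open>h\<close>.

  The commutator ideal of \<open>A\<^sub>h\<close> is generated by \<open>h\<close> (\<open>ore_commutator_in_ideal\<close>), and \<open>A\<^sub>h\<close> is a
  domain on which the \<open>t\<close>-degree is additive (\<open>degree_ore_mult\<close>). An automorphism \<open>\<rho>\<close> preserves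
  the commutator ideal, so it sends \<open>h\<close> to an associate of \<open>h\<close>; a linear factor \<open>x - r\<close> of \<open>h\<close> is
  then sent into \<open>k[x]\<close>, and comparing degrees in \<open>[\<rho> t, \<rho> x] = \<rho> h\<close> gives the triangular shape
  \<open>\<rho> x = \<alpha> x + \<beta>\<close>, \<open>\<rho> t = \<gamma> t + p(x)\<close> (\<open>ore_Aut_triangular\<close>). Thus the degree of \<open>\<rho>\<close> is large
  exactly when that of \<open>p\<close> is.

  If \<open>D\<close> is locally nilpotent, the same ideal shows that \<open>h\<close> divides \<open>D h\<close>. In a domain of
  characteristic zero the order of nilpotency under \<open>D\<close> is additive on products, which forces
  \<open>D h = 0\<close>, then \<open>D (x - r) = 0\<close> for a linear factor of \<open>h\<close>, hence \<open>D x = 0\<close>; finally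
  \<open>[D t, x] = 0\<close> puts \<open>D t\<close> into \<open>k[x]\<close> (\<open>lnd_triangular\<close>). Every shear \<open>x \<mapsto> x\<close>,
  \<open>t \<mapsto> t + q(x)\<close> commutes with such a \<open>D\<close>, and \<open>q\<close> may have any degree.

  Conversely, let \<open>\<rho>\<close> commute with \<open>D\<close> and let \<open>N = deg p\<close> be large compared with the fixed
  elements \<open>D x\<close> and \<open>D t\<close>. In \<open>\<rho> u\<close> every \<open>t\<close> of \<open>u\<close> contributes \<open>N\<close> to the degree of the part
  free of \<open>t\<close> (\<open>degree_triangular_action\<close>). Applied to \<open>\<rho> (D x) = \<alpha> (D x)\<close> and
  \<open>\<rho> (D t) = p' (D x) + \<gamma> (D t)\<close> this gives \<open>D x = f(x)\<close> and \<open>D t = g\<^sub>0(x) + g\<^sub>1(x) t\<close>, and the top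
  coefficients of the second equation then satisfy \<open>N f\<^sub>e = (x g\<^sub>1)\<^sub>e\<close>. Since two different values of
  \<open>N\<close> occur, both sides vanish, so \<open>f = g\<^sub>1 = 0\<close>.
\<close>

section \<open>The degree in \<open>t\<close>\<close>

lemma ore_mult_0_right [simp]: "ore_mult h u 0 = 0"
proof (rule add_left_imp_eq)
  show "ore_mult h u 0 + ore_mult h u 0 = ore_mult h u 0 + 0"
    by (simp only: add_0_right flip: ore_mult_add_right)
qed

lemma ore_mult_monom_right: "ore_mult h u (monom 1 n) = u * monom 1 n"
proof (induction u arbitrary: n)
  case (pCons a u)
  have "ore_tmult h (monom 1 n) = monom 1 (Suc n)"
    using funpow_ore_tmult_monom[of 1 h n] by simp
  then show ?case
    by (simp add: ore_mult_pCons_left pCons.IH) (simp add: monom_Suc)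
qed simp

lemma ore_mult_t_right: "ore_mult h u ore_t = pCons 0 u"
proof -
  have t: "ore_t = monom 1 1"
    by (simp add: ore_t_def monom_altdef)
  have "ore_mult h u ore_t = u * ore_t"
    unfolding t by (rule ore_mult_monom_right)
  then show ?thesis
    by (simp add: ore_t_def)
qed

lemma pCons_eq_ore: "pCons a u = [:a:] + ore_mult h u ore_t"
  by (simp add: ore_mult_t_right)

text \<open>
  Commuting \<open>t\<close> past a coefficient only produces terms of lower \<open>t\<close>-degree, so leading
  coefficients in \<open>t\<close> behave as in the commutative ring.
\<close>

lemma funpow_ore_tmult_top:
  assumes "degree v \<le> m"
  shows "degree ((ore_tmult h ^^ j) v) \<le> m + j \<and> coeff ((ore_tmult h ^^ j) v) (m + j) = coeff v m"
proof (induction j)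
  case (Suc j)
  let ?w = "(ore_tmult h ^^ j) v"
  have w: "coeff ?w i = 0" if "i > m + j" for i
    using Suc that by (auto intro: coeff_eq_0)
  have "degree (ore_tmult h ?w) \<le> m + Suc j"
    by (rule degree_le) (auto simp: coeff_ore_tmult w split: nat.split)
  moreover have "coeff (ore_tmult h ?w) (m + Suc j) = coeff v m"
    using Suc by (simp add: coeff_ore_tmult w)
  ultimately show ?case by simp
qed (use assms in simp)

lemma ore_mult_top:
  "degree (ore_mult h u v) \<le> degree u + degree v \<and>
   coeff (ore_mult h u v) (degree u + degree v) = lead_coeff u * lead_coeff v"
proof -
  let ?T = "\<lambda>j. (ore_tmult h ^^ j) v"
  have T: "coeff (?T j) i = 0" if "i > degree v + j" for i j
    using funpow_ore_tmult_top[of v "degree v" j h] that by (auto intro: coeff_eq_0)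
  have "coeff (ore_mult h u v) i = 0" if "i > degree u + degree v" for i
    unfolding ore_mult_def coeff_sum using that by (intro sum.neutral) (auto simp: T)
  then have "degree (ore_mult h u v) \<le> degree u + degree v"
    by (intro degree_le) auto
  moreover have "coeff (ore_mult h u v) (degree u + degree v)
      = (\<Sum>j\<le>degree u. if j = degree u then lead_coeff u * lead_coeff v else 0)"
    unfolding ore_mult_def coeff_sum
    using funpow_ore_tmult_top[of v "degree v" "degree u" h]
    by (intro sum.cong) (auto simp: T add.commute)
  ultimately show ?thesis by simp
qed

lemma ore_mult_eq_0_iff [simp]: "ore_mult h u v = 0 \<longleftrightarrow> u = 0 \<or> v = 0"
  using ore_mult_top[of h u v] by auto

text \<open>
  Leading coefficients multiply in the domain \<open>k[x]\<close>. The use of this additivity is that all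
  divisors of nonzero elements of \<open>k[x]\<close> lie in \<open>k[x]\<close> again.
\<close>

lemma degree_ore_mult:
  assumes "u \<noteq> 0" "v \<noteq> 0"
  shows "degree (ore_mult h u v) = degree u + degree v"
  by (rule antisym) (use ore_mult_top[of h u v] assms in \<open>auto intro!: le_degree\<close>)


section \<open>Commutators\<close>

text \<open>
  Modulo \<open>h\<close> the variables commute, so the product of \<open>A\<^sub>h\<close> agrees with that of \<open>k[x][t]\<close> there.
\<close>

lemma dvd_ore_mult_minus_times: "[:h:] dvd ore_mult h u v - u * v"
proof (induction u arbitrary: v)
  case (pCons a u)
  have "ore_tmult h v = pCons 0 v + smult h (map_poly pderiv v)"
    by (rule poly_eqI) (simp add: coeff_ore_tmult coeff_pCons coeff_map_poly ore_deriv_def split: nat.split)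
  then have "ore_mult h (pCons a u) v - pCons a u * v
      = (ore_mult h u (ore_tmult h v) - u * ore_tmult h v) + [:h:] * (u * map_poly pderiv v)"
    by (simp add: ore_mult_pCons_left algebra_simps)
  with pCons.IH show ?case
    by (metis dvd_add dvd_triv_left)
qed simp

text \<open>
  Every commutator is therefore a multiple of \<open>h = t x - x t\<close>: the ideal generated by \<open>h\<close> is the
  commutator ideal, which is what makes it invariant under automorphisms and derivations.
\<close>

lemma ore_commutator_in_ideal:
  obtains w where "ore_mult h u v - ore_mult h v u = ore_mult h [:h:] w"
proof -
  have "[:h:] dvd (ore_mult h u v - u * v) - (ore_mult h v u - v * u)"
    by (intro dvd_diff dvd_ore_mult_minus_times)
  then obtain w where "(ore_mult h u v - u * v) - (ore_mult h v u - v * u) = [:h:] * w"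
    by (rule dvdE)
  then show ?thesis
    by (intro that[of w]) (simp add: mult.commute)
qed

lemma coeff_funpow_ore_tmult_const:
  "coeff ((ore_tmult h ^^ Suc j) [:a:]) j = of_nat (Suc j) * ore_deriv h a"
proof (induction j)
  case (Suc j)
  have "coeff ((ore_tmult h ^^ Suc j) [:a:]) (Suc j) = a"
    using funpow_ore_tmult_top[of "[:a:]" 0 "Suc j" h] by simp
  moreover have "(ore_tmult h ^^ Suc (Suc j)) [:a:] = ore_tmult h ((ore_tmult h ^^ Suc j) [:a:])"
    by simp
  ultimately show ?case
    using Suc by (simp only: coeff_ore_tmult) (simp add: algebra_simps)
qed (simp add: coeff_ore_tmult)

text \<open>
  The terms of \<open>t\<close>-degree \<open>r + 1\<close> cancel in the commutator with \<open>a \<in> k[x]\<close>, and the next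
  coefficient has no contribution from lower terms of \<open>u\<close> because \<open>k[x]\<close> is commutative. In
  characteristic zero the commutator with a nonconstant \<open>a\<close> thus lowers the \<open>t\<close>-degree by exactly
  one; in particular the centraliser of \<open>x\<close> is \<open>k[x]\<close>.
\<close>

lemma coeff_commutator_const:
  assumes "degree u \<le> Suc r"
  shows "coeff (ore_mult h u [:a:] - ore_mult h [:a:] u) r
         = of_nat (Suc r) * ore_deriv h a * coeff u (Suc r)"
proof -
  let ?T = "\<lambda>j. (ore_tmult h ^^ j) [:a:]"
  have T: "coeff (?T j) i = 0" if "i > j" for i j
    using funpow_ore_tmult_top[of "[:a:]" 0 j h] that by (auto intro: coeff_eq_0)
  have top: "coeff (?T r) r = a"
    using funpow_ore_tmult_top[of "[:a:]" 0 r h] by simp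
  have "coeff (ore_mult h u [:a:]) r = (\<Sum>j\<le>Suc r. coeff u j * coeff (?T j) r)"
    by (simp only: ore_mult_eq[OF assms] coeff_sum coeff_smult)
  also have "\<dots> = (\<Sum>j<r. coeff u j * coeff (?T j) r) + coeff u r * a
      + coeff u (Suc r) * (of_nat (Suc r) * ore_deriv h a)"
    by (simp only: lessThan_Suc_atMost[symmetric] sum.lessThan_Suc top coeff_funpow_ore_tmult_const)
  also have "(\<Sum>j<r. coeff u j * coeff (?T j) r) = 0"
    by (intro sum.neutral) (auto simp: T)
  finally show ?thesis
    by (simp add: algebra_simps)
qed

lemma nonconst_has_linear_factor:
  fixes h :: "'k::alg_closed_field poly"
  assumes "degree h > 0"
  obtains r q where "h = [:-r, 1:] * q"
  using alg_closed_imp_poly_has_root[OF assms] by (metis dvdE poly_eq_0_iff_dvd)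


section \<open>Automorphisms are triangular\<close>

lemma ore_Aut_iff:
  "\<rho> \<in> ore_Aut h \<longleftrightarrow> bij \<rho> \<and> \<rho> 1 = 1 \<and> (\<forall>u v. \<rho> (u + v) = \<rho> u + \<rho> v) \<and>
     (\<forall>u v. \<rho> (ore_mult h u v) = ore_mult h (\<rho> u) (\<rho> v)) \<and>
     (\<forall>c u. \<rho> (ore_scale c u) = ore_scale c (\<rho> u))"
  by (auto simp: ore_Aut_def ring_iso_def ring_hom_def ore_ext_def Vector_Spaces.linear_iff
      vector_space_ore_scale)

lemma ore_Aut_const:
  assumes "\<rho> \<in> ore_Aut h"
  shows "\<rho> [:[:c:]:] = [:[:c:]:]"
proof -
  have "[:[:c:]:] = ore_scale c (1 :: 'a poly poly)"
    by (simp add: ore_scale_def flip: one_pCons)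
  then show ?thesis
    using assms by (simp add: ore_Aut_iff)
qed

lemma const_pCons_eq_ore: "[:pCons c p:] = [:[:c:]:] + ore_mult h ore_x [:p:]"
  by (simp add: ore_x_def)

lemma ore_Aut_pcompose:
  assumes "\<rho> \<in> ore_Aut h" "\<rho> ore_x = [:q:]"
  shows "\<rho> [:p:] = [:pcompose p q:]"
proof (induction p)
  case 0
  then show ?case using ore_Aut_const[OF assms(1), of 0] by simp
next
  case (pCons c p)
  then show ?case
    using assms by (simp add: const_pCons_eq_ore[of c p h] ore_Aut_iff ore_Aut_const[OF assms(1)]
        pcompose_pCons del: add_pCons) simp
qed

text \<open>
  The element \<open>\<rho> h\<close> is a commutator, hence a multiple of \<open>h\<close>; and \<open>h\<close>, being the image of a
  commutator, is a multiple of \<open>\<rho> h\<close>. By additivity of the \<open>t\<close>-degree all elements involved lie in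
  \<open>k[x]\<close>, and so does \<open>\<rho>\<close> of each linear factor of \<open>h\<close>. This settles \<open>\<rho> x\<close>, and the shape of
  \<open>\<rho> t\<close> is read off from \<open>[\<rho> t, \<rho> x] = \<rho> h\<close>.
\<close>

lemma ore_Aut_triangular:
  fixes h :: "'k::{alg_closed_field, field_char_0} poly"
  assumes \<rho>: "\<rho> \<in> ore_Aut h" and h: "degree h > 0"
  obtains q p \<gamma> where "degree q = 1" "\<gamma> \<noteq> 0" "\<rho> ore_x = [:q:]" "\<rho> ore_t = [:p, [:\<gamma>:]:]"
proof -
  have add: "\<rho> (u + v) = \<rho> u + \<rho> v" and mult: "\<rho> (ore_mult h u v) = ore_mult h (\<rho> u) (\<rho> v)" for u v
    using \<rho> by (simp_all add: ore_Aut_iff)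
  have inj: "inj \<rho>" and surj: "surj \<rho>"
    using \<rho> by (simp_all add: ore_Aut_iff bij_is_inj bij_is_surj)
  have 0: "\<rho> 0 = 0"
    using add[of 0 0] by simp
  have diff: "\<rho> (u - v) = \<rho> u - \<rho> v" for u v
    using add[of "u - v" v] by simp
  have h0: "[:h:] \<noteq> 0"
    using h by auto
  then have \<rho>h0: "\<rho> [:h:] \<noteq> 0"
    using inj 0 by (metis injD)
  have comm: "ore_mult h (\<rho> ore_t) (\<rho> ore_x) - ore_mult h (\<rho> ore_x) (\<rho> ore_t) = \<rho> [:h:]"
    by (simp only: flip: ore_commutation[of h] mult diff)
  obtain u where u: "\<rho> [:h:] = ore_mult h [:h:] u"
    using comm ore_commutator_in_ideal by metis
  \<comment> \<open>Surjectivity exhibits \<open>h = [t, x]\<close> as the image of a commutator.\<close>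
  obtain t' x' where "\<rho> t' = ore_t" "\<rho> x' = ore_x"
    using surj by (metis surjD)
  moreover obtain w where "ore_mult h t' x' - ore_mult h x' t' = ore_mult h [:h:] w"
    using ore_commutator_in_ideal by metis
  ultimately have "[:h:] = ore_mult h (\<rho> [:h:]) (\<rho> w)"
    by (metis mult diff ore_commutation)
  then obtain v where v: "[:h:] = ore_mult h (\<rho> [:h:]) v" ..
  have "v \<noteq> 0" "u \<noteq> 0"
    using u v h0 \<rho>h0 by auto
  have "degree (\<rho> [:h:]) = 0" "degree v = 0"
    using degree_ore_mult[OF \<rho>h0 \<open>v \<noteq> 0\<close>, of h] by (simp_all flip: v)
  then obtain h' v' where h': "\<rho> [:h:] = [:h':]" and v': "v = [:v':]"
    by (meson degree_eq_zeroE)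
  have "degree (\<rho> [:h:]) = degree [:h:] + degree u"
    unfolding u by (rule degree_ore_mult[OF h0 \<open>u \<noteq> 0\<close>])
  then have "degree u = 0"
    using h' by simp
  then obtain u' where u': "u = [:u':]"
    by (meson degree_eq_zeroE)
  have "h' = h * u'" "h = h' * v'"
    using u v by (simp_all add: h' u' v')
  then have deg_h': "degree h' = degree h"
  proof -
    have "h' dvd h" "h dvd h'"
      using \<open>h = h' * v'\<close> \<open>h' = h * u'\<close> by (auto intro: dvdI)
    moreover have "h \<noteq> 0" "h' \<noteq> 0"
      using h0 \<rho>h0 h' by auto
    ultimately show ?thesis
      by (intro antisym dvd_imp_degree_le)
  qed
  \<comment> \<open>A linear factor of \<open>h\<close> is sent to a divisor of an element of \<open>k[x]\<close>.\<close>
  obtain r g where rg: "h = [:-r, 1:] * g"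
    using nonconst_has_linear_factor[OF h] .
  have "[:h:] = ore_mult h [:[:-r, 1:]:] [:g:]"
    using rg by simp
  then have f: "[:h':] = ore_mult h (\<rho> [:[:-r, 1:]:]) (\<rho> [:g:])"
    by (metis h' mult)
  have "\<rho> [:[:-r, 1:]:] \<noteq> 0" "\<rho> [:g:] \<noteq> 0"
    using f \<rho>h0 h' by auto
  then have "degree (\<rho> [:[:-r, 1:]:]) = 0"
    using degree_ore_mult[of "\<rho> [:[:-r, 1:]:]" "\<rho> [:g:]" h] by (simp flip: f)
  moreover have "\<rho> [:[:-r, 1:]:] = [:[:-r:]:] + \<rho> ore_x"
    using add[of "[:[:-r:]:]" ore_x] ore_Aut_const[OF \<rho>] by (simp add: ore_x_def)
  then have "\<rho> ore_x = \<rho> [:[:-r, 1:]:] + [:[:r:]:]"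
    by simp
  ultimately have "degree (\<rho> ore_x) = 0"
    using degree_add_le[of "\<rho> [:[:-r, 1:]:]" 0 "[:[:r:]:]"] by simp
  then obtain q where q: "\<rho> ore_x = [:q:]"
    by (meson degree_eq_zeroE)
  have h'_eq: "h' = pcompose h q"
    using ore_Aut_pcompose[OF \<rho> q, of h] h' by simp
  then have deg_q: "degree q = 1"
    using deg_h' h by (simp add: degree_pcompose)
  \<comment> \<open>\<open>[\<rho> t, q]\<close> has \<open>t\<close>-degree one less than \<open>\<rho> t\<close>, and it equals \<open>h'\<close>, of \<open>t\<close>-degree 0.\<close>
  define s where "s = degree (\<rho> ore_t)"
  have "s \<noteq> 0"
  proof
    assume "s = 0"
    then obtain b where "\<rho> ore_t = [:b:]"
      unfolding s_def by (meson degree_eq_zeroE)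
    then show False
      using comm \<rho>h0 by (simp add: q)
  qed
  then obtain s' where s': "s = Suc s'"
    by (cases s) auto
  have c: "coeff [:h':] s' = of_nat (Suc s') * ore_deriv h q * coeff (\<rho> ore_t) (Suc s')"
  proof -
    have "ore_mult h (\<rho> ore_t) [:q:] - ore_mult h [:q:] (\<rho> ore_t) = [:h':]"
      using comm by (simp only: q h')
    then show ?thesis
      using coeff_commutator_const[of "\<rho> ore_t" s' h q] s' by (simp only: s_def order_refl)
  qed
  have lc0: "coeff (\<rho> ore_t) (Suc s') \<noteq> 0"
    using s' \<open>s \<noteq> 0\<close> unfolding s_def by (metis degree_0 leading_coeff_0_iff)
  have dq: "pderiv q \<noteq> 0"
    using deg_q by (simp add: pderiv_eq_0_iff)
  have "coeff [:h':] s' \<noteq> 0"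
    unfolding c using lc0 dq h by (auto simp: ore_deriv_def simp del: of_nat_Suc)
  then have "s' = 0"
    by (cases s') auto
  then have "h' = h * (pderiv q * coeff (\<rho> ore_t) 1)"
    using c by (simp add: ore_deriv_def mult.assoc)
  then have "degree h' = degree h + (degree (pderiv q) + degree (coeff (\<rho> ore_t) 1))"
  proof -
    have "h \<noteq> 0" "coeff (\<rho> ore_t) 1 \<noteq> 0"
      using h lc0 \<open>s' = 0\<close> by auto
    then show ?thesis
      unfolding \<open>h' = h * (pderiv q * coeff (\<rho> ore_t) 1)\<close> using dq
      by (subst degree_mult_eq) (simp_all add: degree_mult_eq)
  qed
  then have "degree (coeff (\<rho> ore_t) 1) = 0"
    using deg_h' by simp
  then obtain \<gamma> where \<gamma>: "coeff (\<rho> ore_t) 1 = [:\<gamma>:]"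
    by (meson degree_eq_zeroE)
  have "\<rho> ore_t = [:coeff (\<rho> ore_t) 0, [:\<gamma>:]:]"
    using \<gamma> s' \<open>s' = 0\<close> by (intro poly_eqI) (auto simp: coeff_pCons s_def coeff_eq_0 split: nat.split)
  moreover have "\<gamma> \<noteq> 0"
    using lc0 \<gamma> \<open>s' = 0\<close> by auto
  ultimately show ?thesis
    using that deg_q q by blast
qed


section \<open>Locally nilpotent derivations\<close>

context
  fixes h :: "'k::field poly" and D :: "'k poly poly \<Rightarrow> 'k poly poly"
  assumes D: "ore_derivation h D"
begin

lemma ore_derivation_add: "D (u + v) = D u + D v"
  and ore_derivation_scale: "D (ore_scale c u) = ore_scale c (D u)"
  and ore_derivation_mult: "D (ore_mult h u v) = ore_mult h (D u) v + ore_mult h u (D v)"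
  using D by (simp_all add: ore_derivation_def Vector_Spaces.linear_iff)

lemma ore_derivation_0: "D 0 = 0"
  using ore_derivation_scale[of 0 0] by (simp add: ore_scale_def)

lemma ore_derivation_diff: "D (u - v) = D u - D v"
  using ore_derivation_add[of "u - v" v] by simp

lemma ore_derivation_const: "D [:[:c:]:] = 0"
proof -
  have "D 1 = 0"
    using ore_derivation_mult[of 1 1]
    by (simp only: ore_mult_1_left ore_mult_1_right add_cancel_right_right)
  moreover have "[:[:c:]:] = ore_scale c (1 :: 'k poly poly)"
    by (simp add: ore_scale_def flip: one_pCons)
  ultimately show ?thesis
    by (simp add: ore_derivation_scale) (simp add: ore_scale_def)
qed

lemma ore_derivation_linear_poly: "D [:[:b, a:]:] = ore_scale a (D ore_x)"
proof -
  have "[:[:b, a:]:] = [:[:b:]:] + ore_scale a ore_x"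
    by (simp add: ore_scale_def ore_x_def)
  then show ?thesis
    by (simp only: ore_derivation_add ore_derivation_const ore_derivation_scale add_0_left)
qed

lemma ore_derivation_poly:
  assumes "D ore_x = [:f:]"
  shows "D [:p:] = [:pderiv p * f:]"
proof (induction p)
  case (pCons c p)
  then show ?case
    by (simp add: const_pCons_eq_ore[of c p h] ore_derivation_add ore_derivation_const
        ore_derivation_mult assms pderiv_pCons del: add_pCons)
      (simp add: ore_x_def algebra_simps)
qed (simp add: ore_derivation_0)

lemma funpow_derivation_0: "(D ^^ n) 0 = 0"
  by (induction n) (simp_all add: ore_derivation_0)

lemma funpow_derivation_add: "(D ^^ n) (u + v) = (D ^^ n) u + (D ^^ n) v"
  by (induction n) (simp_all add: ore_derivation_add)

lemma funpow_derivation_mono: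
  assumes "(D ^^ m) u = 0" "m \<le> n"
  shows "(D ^^ n) u = 0"
proof -
  have "(D ^^ n) u = (D ^^ (n - m)) ((D ^^ m) u)"
    using assms(2) by (simp flip: funpow_add[unfolded o_def fun_eq_iff, rule_format])
  then show ?thesis
    by (simp add: assms(1) funpow_derivation_0)
qed

text \<open>
  This is the step showing that the elements killed by some power of \<open>D\<close> form a subalgebra, so that
  local nilpotence only needs to be checked on the generators \<open>x\<close> and \<open>t\<close>. Each application of the
  Leibniz rule lowers \<open>m\<close> or \<open>n\<close> by one.
\<close>

lemma nilpotent_mult:
  assumes "(D ^^ m) u = 0" "(D ^^ n) v = 0"
  shows "\<exists>k. (D ^^ k) (ore_mult h u v) = 0"
  using assms
proof (induction "m + n" arbitrary: m n u v)
  case 0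
  then show ?case by (intro exI[of _ 0]) simp
next
  case (Suc N)
  show ?case
  proof (cases "m = 0 \<or> n = 0")
    case True
    then show ?thesis
      using Suc.prems by (intro exI[of _ 0]) auto
  next
    case False
    then obtain m' n' where mn: "m = Suc m'" "n = Suc n'"
      by (metis not0_implies_Suc)
    have "\<exists>k. (D ^^ k) (ore_mult h (D u) v) = 0"
      using Suc.hyps(2) Suc.prems by (intro Suc.hyps(1)[of m' n]) (simp_all add: mn funpow_swap1)
    moreover have "\<exists>k. (D ^^ k) (ore_mult h u (D v)) = 0"
      using Suc.hyps(2) Suc.prems by (intro Suc.hyps(1)[of m n']) (simp_all add: mn funpow_swap1)
    ultimately obtain k l where "(D ^^ k) (ore_mult h (D u) v) = 0" "(D ^^ l) (ore_mult h u (D v)) = 0"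
      by blast
    then have "(D ^^ (k + l)) (D (ore_mult h u v)) = 0"
      by (simp add: ore_derivation_mult funpow_derivation_add
          funpow_derivation_mono[of k _ "k + l"] funpow_derivation_mono[of l _ "k + l"])
    then show ?thesis
      by (intro exI[of _ "Suc (k + l)"]) (simp add: funpow_swap1)
  qed
qed

lemma locally_nilpotentI:
  assumes "D ore_x = 0" "D ore_t = [:g:]"
  shows "locally_nilpotent D"
proof -
  have const: "D [:a:] = 0" for a
    using ore_derivation_poly[of 0 a] assms(1) by simp
  have "\<exists>k. (D ^^ k) u = 0" for u
  proof (induction u)
    case 0
    then show ?case by (intro exI[of _ 0]) simp
  next
    case (pCons a u)
    obtain k where "(D ^^ k) u = 0"
      using pCons.IH ..
    moreover have "(D ^^ 2) ore_t = 0"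
      by (simp add: numeral_2_eq_2 assms(2) const)
    ultimately obtain l where "(D ^^ l) (ore_mult h u ore_t) = 0"
      using nilpotent_mult by blast
    moreover have "(D ^^ Suc l) [:a:] = 0"
      by (simp only: funpow_Suc_right o_def const funpow_derivation_0)
    ultimately have "(D ^^ Suc l) (pCons a u) = 0"
      by (simp only: pCons_eq_ore[of a u h] funpow_derivation_add) (simp add: ore_derivation_0)
    then show ?case ..
  qed
  then show ?thesis
    unfolding locally_nilpotent_def
    by (metis One_nat_def funpow_derivation_mono le_add2 le_add1 plus_1_eq_Suc)
qed

text \<open>
  In the Leibniz expansion of \<open>D\<^sup>m\<^sup>+\<^sup>n (u v)\<close> every other term applies \<open>D\<close> more than \<open>m\<close> times to
  \<open>u\<close> or more than \<open>n\<close> times to \<open>v\<close>.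
\<close>

lemma funpow_derivation_mult_top:
  assumes "(D ^^ Suc m) u = 0" "(D ^^ Suc n) v = 0"
  shows "(D ^^ (m + n)) (ore_mult h u v)
         = of_nat ((m + n) choose m) * ore_mult h ((D ^^ m) u) ((D ^^ n) v)"
  using assms
proof (induction "m + n" arbitrary: m n u v)
  case 0
  then show ?case by simp
next
  case (Suc N)
  have step: "(D ^^ (m + n)) (ore_mult h u v)
      = (D ^^ N) (ore_mult h (D u) v) + (D ^^ N) (ore_mult h u (D v))"
    by (simp add: Suc.hyps(2)[symmetric] funpow_swap1 ore_derivation_mult funpow_derivation_add)
  have left: "(D ^^ N) (ore_mult h (D u) v)
      = of_nat (N choose m') * ore_mult h ((D ^^ m) u) ((D ^^ n) v)" if "m = Suc m'" for m'
    using Suc.hyps(1)[of m' n "D u" v] Suc.hyps(2) Suc.prems that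
    by (simp add: funpow_swap1)
  have right: "(D ^^ N) (ore_mult h u (D v))
      = of_nat (N choose m) * ore_mult h ((D ^^ m) u) ((D ^^ n) v)" if "n = Suc n'" for n'
    using Suc.hyps(1)[of m n' u "D v"] Suc.hyps(2) Suc.prems that
    by (simp add: funpow_swap1)
  show ?case
  proof (cases m)
    case 0
    then have "D u = 0" "n = Suc N"
      using Suc by simp_all
    then show ?thesis
      using step right 0 by (simp add: funpow_derivation_0)
  next
    case m: (Suc m')
    show ?thesis
    proof (cases n)
      case 0
      then have "D v = 0" "m' = N"
        using Suc m by simp_all
      then show ?thesis
        using step left[OF m] 0 m by (simp add: funpow_derivation_0)
    next
      case n: (Suc n')
      have "(m + n) choose m = (N choose m') + (N choose m)"
        using Suc.hyps(2) m by simp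
      then show ?thesis
        using step left[OF m] right[OF n] by (simp add: algebra_simps)
    qed
  qed
qed

lemma nilpotency_order:
  assumes "locally_nilpotent D" "u \<noteq> 0"
  obtains m where "(D ^^ m) u \<noteq> 0" "(D ^^ Suc m) u = 0"
proof -
  define k where "k = (LEAST k. (D ^^ k) u = 0)"
  have "\<exists>k. (D ^^ k) u = 0"
    using assms(1) by (auto simp: locally_nilpotent_def)
  then have k: "(D ^^ k) u = 0"
    unfolding k_def by (rule LeastI_ex)
  then have "k \<noteq> 0"
    using assms(2) by (cases k) auto
  then obtain m where "k = Suc m"
    by (cases k) auto
  moreover from this have "(D ^^ m) u \<noteq> 0"
    using not_less_Least[of m "\<lambda>k. (D ^^ k) u = 0"] k_def by simp
  ultimately show ?thesis
    using that k by simp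
qed

end

text \<open>
  In characteristic zero the binomial coefficient above does not vanish, so orders of nilpotency
  add up on products in the domain \<open>A\<^sub>h\<close>. The lower bound for the order of the product is the part
  that restricts locally nilpotent derivations.
\<close>

lemma nilpotency_order_mult:
  fixes h :: "'k::field_char_0 poly"
  assumes "ore_derivation h D" "locally_nilpotent D" "u \<noteq> 0" "v \<noteq> 0"
  obtains m n where "(D ^^ Suc m) u = 0" "(D ^^ Suc n) v = 0" "(D ^^ (m + n)) (ore_mult h u v) \<noteq> 0"
proof -
  obtain m where m: "(D ^^ m) u \<noteq> 0" "(D ^^ Suc m) u = 0"
    using nilpotency_order[OF assms(1,2,3)] .
  obtain n where n: "(D ^^ n) v \<noteq> 0" "(D ^^ Suc n) v = 0"
    using nilpotency_order[OF assms(1,2,4)] .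
  have "of_nat ((m + n) choose m) \<noteq> (0 :: 'k poly poly)"
    by simp
  then show ?thesis
    using that m n funpow_derivation_mult_top[OF assms(1) m(2) n(2)] by simp
qed

text \<open>Orders are nonnegative and add up, so a product of order zero has factors of order zero.\<close>

lemma lnd_kernel_factorially_closed:
  fixes h :: "'k::field_char_0 poly"
  assumes D: "ore_derivation h D" "locally_nilpotent D"
    and "ore_mult h u v \<noteq> 0" "D (ore_mult h u v) = 0"
  shows "D u = 0"
proof -
  have "u \<noteq> 0" "v \<noteq> 0"
    using assms(3) by auto
  then obtain m n where mn: "(D ^^ Suc m) u = 0" "(D ^^ (m + n)) (ore_mult h u v) \<noteq> 0"
    by (rule nilpotency_order_mult[OF D])
  have "m + n = 0"
  proof (rule ccontr)
    assume "m + n \<noteq> 0"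
    then have "1 \<le> m + n"
      by linarith
    moreover have "(D ^^ 1) (ore_mult h u v) = 0"
      using assms(4) by simp
    ultimately show False
      using mn(2) funpow_derivation_mono[OF D(1)] by blast
  qed
  then show ?thesis
    using mn(1) by simp
qed

text \<open>
  Applying \<open>D\<close> lowers the order of an element by one, while multiplying by a nonzero element does
  not lower it.
\<close>

lemma lnd_multiple_eq_0:
  fixes h :: "'k::field_char_0 poly"
  assumes D: "ore_derivation h D" "locally_nilpotent D" and "D u = ore_mult h u v"
  shows "D u = 0"
proof (rule ccontr)
  assume "D u \<noteq> 0"
  then have "u \<noteq> 0" "v \<noteq> 0"
    using assms(3) by auto
  then obtain m n where mn: "(D ^^ Suc m) u = 0" "(D ^^ (m + n)) (ore_mult h u v) \<noteq> 0"
    by (rule nilpotency_order_mult[OF D])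
  have "(D ^^ (m + n)) (ore_mult h u v) = (D ^^ Suc (m + n)) u"
    by (simp only: funpow_Suc_right o_def assms(3))
  also have "\<dots> = 0"
    by (rule funpow_derivation_mono[OF D(1) mn(1)]) simp
  finally show False
    using mn(2) by simp
qed

text \<open>
  Differentiating \<open>h = t x - x t\<close> gives a sum of commutators, that is, a multiple of \<open>h\<close>; so \<open>D h = 0\<close>,
  and the kernel contains the linear factors of \<open>h\<close>. Then \<open>[D t, x] = D h = 0\<close> places \<open>D t\<close> in the
  centraliser of \<open>x\<close>.
\<close>

lemma lnd_triangular:
  fixes h :: "'k::{alg_closed_field, field_char_0} poly"
  assumes D: "ore_derivation h D" "locally_nilpotent D" and h: "degree h > 0"
  obtains g where "D ore_x = 0" "D ore_t = [:g:]"
proof -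
  have h0: "[:h:] \<noteq> 0"
    using h by auto
  have Dh: "D [:h:] = (ore_mult h (D ore_t) ore_x - ore_mult h ore_x (D ore_t))
      + (ore_mult h ore_t (D ore_x) - ore_mult h (D ore_x) ore_t)"
    by (simp flip: ore_commutation[of h]
        add: ore_derivation_diff[OF D(1)] ore_derivation_mult[OF D(1)])
  obtain w w' where
    "ore_mult h (D ore_t) ore_x - ore_mult h ore_x (D ore_t) = ore_mult h [:h:] w"
    "ore_mult h ore_t (D ore_x) - ore_mult h (D ore_x) ore_t = ore_mult h [:h:] w'"
    by (metis ore_commutator_in_ideal)
  then have "D [:h:] = ore_mult h [:h:] (w + w')"
    by (simp only: Dh ore_mult_add_right)
  then have Dh0: "D [:h:] = 0"
    by (rule lnd_multiple_eq_0[OF D])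
  obtain r g where rg: "h = [:-r, 1:] * g"
    using nonconst_has_linear_factor[OF h] .
  then have "[:h:] = ore_mult h [:[:-r, 1:]:] [:g:]"
    by simp
  then have "D [:[:-r, 1:]:] = 0"
    using Dh0 h0 lnd_kernel_factorially_closed[OF D] by metis
  then have Dx: "D ore_x = 0"
    by (simp add: ore_derivation_linear_poly[OF D(1)] ore_scale_def)
  have "degree (D ore_t) = 0"
  proof (rule ccontr)
    assume "degree (D ore_t) \<noteq> 0"
    then obtain s where s: "degree (D ore_t) = Suc s"
      by (cases "degree (D ore_t)") auto
    have "ore_mult h (D ore_t) ore_x - ore_mult h ore_x (D ore_t) = 0"
      using Dh Dh0 Dx by simp
    then have "of_nat (Suc s) * ore_deriv h [:0, 1:] * coeff (D ore_t) (Suc s) = 0"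
      using coeff_commutator_const[of "D ore_t" s h "[:0, 1:]"] s by (simp add: ore_x_def)
    moreover have "coeff (D ore_t) (Suc s) \<noteq> 0"
      using s by (metis degree_0 leading_coeff_0_iff nat.distinct(1))
    ultimately show False
      using h by (auto simp: ore_deriv_def pderiv_pCons simp del: of_nat_Suc)
  qed
  then show ?thesis
    using that Dx by (meson degree_eq_zeroE)
qed


section \<open>Shears\<close>

text \<open>
  The endomorphism \<open>x \<mapsto> x\<close>, \<open>t \<mapsto> t + q\<close>, written as a noncommutative Horner scheme: the normal form
  \<open>\<Sum>\<^sub>j a\<^sub>j t\<^sup>j\<close> is evaluated at \<open>t + q\<close> with the coefficients kept on the left.
\<close>

definition ore_shear :: "'k::field poly \<Rightarrow> 'k poly \<Rightarrow> 'k poly poly \<Rightarrow> 'k poly poly" where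
  "ore_shear h q u = fold_coeffs (\<lambda>a v. [:a:] + ore_mult h v [:q, 1:]) u 0"

lemma ore_shear_0 [simp]: "ore_shear h q 0 = 0"
  by (simp add: ore_shear_def)

lemma ore_shear_pCons:
  "ore_shear h q (pCons a u) = [:a:] + ore_mult h (ore_shear h q u) [:q, 1:]"
  by (cases "a = 0 \<and> u = 0") (auto simp: ore_shear_def)

lemma ore_shear_const [simp]: "ore_shear h q [:a:] = [:a:]"
  by (simp add: ore_shear_pCons)

lemma ore_shear_t: "ore_shear h q ore_t = [:q, 1:]"
  by (simp add: ore_t_def ore_shear_pCons)

lemma ore_shear_add: "ore_shear h q (u + v) = ore_shear h q u + ore_shear h q v"
  by (induction u v rule: poly_induct2)
    (simp_all add: ore_shear_pCons ore_mult_add_left)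

lemma ore_shear_smult: "ore_shear h q (smult a u) = smult a (ore_shear h q u)"
  by (induction u) (simp_all add: ore_shear_pCons ore_mult_smult_left smult_add_right)

text \<open>
  Multiplicativity rests on \<open>t + q\<close> satisfying the defining relation of \<open>t\<close>, namely
  \<open>(t + q) a = a (t + q) + h a'\<close> for \<open>a \<in> k[x]\<close>.
\<close>

lemma ore_shear_tmult:
  "ore_shear h q (ore_tmult h v) = ore_mult h [:q, 1:] (ore_shear h q v)"
proof (induction v)
  case (pCons a v)
  let ?e = "[:q, 1:]"
  have "ore_tmult h (pCons a v) = pCons 0 [:a:] + pCons (ore_deriv h a) (ore_tmult h v)"
    by (rule poly_eqI) (simp add: coeff_ore_tmult coeff_pCons split: nat.split)
  then have "ore_shear h q (ore_tmult h (pCons a v))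
      = (smult a ?e + [:ore_deriv h a:]) + ore_mult h ?e (ore_mult h (ore_shear h q v) ?e)"
    by (simp add: ore_shear_add ore_shear_pCons pCons.IH ore_mult_assoc del: add_pCons)
  also have "smult a ?e + [:ore_deriv h a:] = ore_mult h ?e [:a:]"
    by (rule poly_eqI)
      (simp add: ore_mult_pCons_left coeff_ore_tmult coeff_pCons split: nat.split)
  finally show ?case
    by (simp add: ore_shear_pCons ore_mult_add_right del: add_pCons)
qed simp

lemma ore_shear_mult:
  "ore_shear h q (ore_mult h u v) = ore_mult h (ore_shear h q u) (ore_shear h q v)"
proof (induction u arbitrary: v)
  case (pCons a u)
  then show ?case
    by (simp add: ore_mult_pCons_left[of h a u v] ore_shear_add ore_shear_smult ore_shear_tmult
        ore_shear_pCons[of h q a u] ore_mult_add_left ore_mult_assoc)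
qed simp

lemma ore_shear_inverse: "ore_shear h (- q) (ore_shear h q u) = u"
proof (induction u)
  case (pCons a u)
  have "[:q, 1:] = [:q:] + ore_t"
    by (simp add: ore_t_def)
  then have "ore_shear h (- q) [:q, 1:] = [:q:] + [:- q, 1:]"
    by (simp only: ore_shear_add ore_shear_const ore_shear_t)
  then have "ore_shear h (- q) [:q, 1:] = ore_t"
    by (simp add: ore_t_def)
  then have "ore_shear h (- q) (ore_shear h q (pCons a u)) = [:a:] + ore_mult h u ore_t"
    by (simp only: ore_shear_pCons[of h q a u] ore_shear_add ore_shear_mult ore_shear_const pCons.IH)
  then show ?case
    by (simp only: pCons_eq_ore[of a u h])
qed simp

lemma ore_shear_in_Aut: "ore_shear h q \<in> ore_Aut h"
proof -
  have "bij (ore_shear h q)"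
    by (rule o_bij[of "ore_shear h (- q)"])
      (use ore_shear_inverse[of h q] ore_shear_inverse[of h "- q"] in \<open>auto simp: fun_eq_iff\<close>)
  then show ?thesis
    by (auto simp: ore_Aut_iff ore_shear_add ore_shear_mult ore_scale_def ore_shear_smult)
      (metis one_pCons ore_shear_const)
qed

text \<open>
  Both compositions of \<open>D\<close> with the shear are twisted derivations, hence determined by their values
  on \<open>x\<close> and \<open>t\<close>. These agree: the shear changes \<open>t\<close> by an element of the kernel of \<open>D\<close> and fixes
  \<open>g\<close>.
\<close>

lemma ore_shear_in_isotropy_group:
  assumes D: "ore_derivation h D" and "D ore_x = 0" "D ore_t = [:g:]"
  shows "ore_shear h q \<in> isotropy_group h D"
proof -
  have const: "D [:a:] = 0" for a
    using ore_derivation_poly[OF D, of 0 a] assms(2) by simp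
  have "[:q, 1:] = [:q:] + ore_t"
    by (simp add: ore_t_def)
  then have e: "D [:q, 1:] = [:g:]"
    by (simp only: ore_derivation_add[OF D] const assms(3) add_0_left)
  have "ore_shear h q (D u) = D (ore_shear h q u)" for u
  proof (induction u)
    case (pCons a u)
    have "D (pCons a u) = ore_mult h (D u) ore_t + ore_mult h u [:g:]"
      by (simp only: pCons_eq_ore[of a u h] ore_derivation_add[OF D] ore_derivation_mult[OF D]
          const assms(3) add_0_left)
    moreover have "D (ore_shear h q (pCons a u))
        = ore_mult h (D (ore_shear h q u)) [:q, 1:] + ore_mult h (ore_shear h q u) [:g:]"
      by (simp only: ore_shear_pCons ore_derivation_add[OF D] ore_derivation_mult[OF D]
          const e add_0_left)
    ultimately show ?case
      by (simp only: ore_shear_add ore_shear_mult ore_shear_t ore_shear_const pCons.IH)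
  qed (simp add: ore_derivation_0[OF D])
  then show ?thesis
    using ore_shear_in_Aut by (auto simp: isotropy_group_def)
qed


section \<open>Total degree\<close>

lemma le_total_deg_iff:
  "ereal (real d) \<le> total_deg u \<longleftrightarrow> (\<exists>i j. coeff (coeff u j) i \<noteq> 0 \<and> d \<le> i + j)"
proof (cases "u = 0")
  case False
  let ?S = "{i + j |i j. coeff (coeff u j) i \<noteq> 0}"
  have "?S \<subseteq> (\<lambda>(j, i). i + j) ` (SIGMA j:{..degree u}. {..degree (coeff u j)})"
  proof
    fix s assume "s \<in> ?S"
    then obtain i j where s: "s = i + j" and c: "coeff (coeff u j) i \<noteq> 0"
      by auto
    then have "i \<le> degree (coeff u j)" "j \<le> degree u"
      by (auto intro!: le_degree)
    then show "s \<in> (\<lambda>(j, i). i + j) ` (SIGMA j:{..degree u}. {..degree (coeff u j)})"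
      using s by (intro image_eqI[of _ _ "(j, i)"]) auto
  qed
  then have fin: "finite ?S"
    by (rule finite_subset) auto
  have "coeff (coeff u (degree u)) (degree (lead_coeff u)) \<noteq> 0"
    using False by simp
  then have "?S \<noteq> {}"
    by blast
  then have "d \<le> Max ?S \<longleftrightarrow> (\<exists>s\<in>?S. d \<le> s)"
    by (rule Max_ge_iff[OF fin])
  then show ?thesis
    using False by (auto simp: total_deg_def)
qed (simp add: total_deg_def)


text \<open>A triangular automorphism can only have large degree through the polynomial \<open>p\<close>.\<close>

lemma aut_deg_triangular:
  assumes "ereal (real d) \<le> aut_deg \<rho>" "\<rho> ore_x = [:q:]" "\<rho> ore_t = [:p, [:\<gamma>:]:]"
    and "degree q < d" "1 < d"
  shows "d \<le> degree p"
proof -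
  consider "ereal (real d) \<le> total_deg [:q:]" | "ereal (real d) \<le> total_deg [:p, [:\<gamma>:]:]"
    using assms(1) by (auto simp: aut_deg_def assms(2,3) le_max_iff_disj)
  then show ?thesis
  proof cases
    case 1
    then obtain i j where "coeff (coeff [:q:] j) i \<noteq> 0" "d \<le> i + j"
      unfolding le_total_deg_iff by blast
    then show ?thesis
      using assms(4) le_degree[of q i] by (cases j) auto
  next
    case 2
    then obtain i j where ij: "coeff (coeff [:p, [:\<gamma>:]:] j) i \<noteq> 0" "d \<le> i + j"
      unfolding le_total_deg_iff by blast
    consider "j = 0" | "j = 1" "i = 0"
      using ij(1) by (auto simp: coeff_pCons split: nat.splits)
    then show ?thesis
      using ij assms(5) le_degree[of p i] by cases auto
  qed
qed


section \<open>The action on polynomials\<close>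

text \<open>
  \<open>A\<^sub>h\<close> acts on \<open>k[x] = A\<^sub>h / A\<^sub>h t\<close> from the left, \<open>x\<close> by multiplication and \<open>t\<close> by \<open>h \<partial>\<^sub>x\<close>. The action
  of \<open>u\<close> on \<open>b\<close> is the \<open>t\<close>-free coefficient of \<open>u b\<close>; the next lemma is associativity of this
  action in disguise. Acting on polynomials avoids expanding powers of \<open>\<gamma> t + p\<close> in normal form.
\<close>

lemma coeff_ore_mult_0:
  "coeff (ore_mult h u v) 0 = coeff (ore_mult h u [:coeff v 0:]) 0"
proof (induction u arbitrary: v)
  case (pCons a u)
  have "coeff (ore_tmult h v) 0 = coeff (ore_tmult h [:coeff v 0:]) 0"
    by (simp add: coeff_ore_tmult)
  then show ?case
    using pCons.IH[of "ore_tmult h v"] pCons.IH[of "ore_tmult h [:coeff v 0:]"]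
    by (simp add: ore_mult_pCons_left)
qed simp

text \<open>
  The operator \<open>\<gamma> h \<partial>\<^sub>x + p\<close> is dominated by multiplication with \<open>p\<close>, since \<open>h \<partial>\<^sub>x\<close> raises degrees by
  at most \<open>deg h - 1\<close>.
\<close>

lemma degree_triangular_t_action:
  fixes h :: "'k::field_char_0 poly"
  assumes "degree h \<le> degree p" "0 < degree p" "b \<noteq> 0"
  shows "degree (coeff (ore_mult h [:p, [:\<gamma>:]:] [:b:]) 0) = degree p + degree b"
proof -
  have eq: "coeff (ore_mult h [:p, [:\<gamma>:]:] [:b:]) 0 = smult \<gamma> (h * pderiv b) + p * b"
    by (simp add: ore_mult_pCons_left coeff_ore_tmult ore_deriv_def)
  have pb: "degree (p * b) = degree p + degree b"
    using assms by (intro degree_mult_eq) auto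
  have "degree (smult \<gamma> (h * pderiv b)) < degree (p * b)"
  proof (cases "degree b = 0")
    case True
    then have "pderiv b = 0"
      by (simp add: pderiv_eq_0_iff)
    then show ?thesis
      using assms pb by simp
  next
    case False
    have "degree (smult \<gamma> (h * pderiv b)) \<le> degree h + degree (pderiv b)"
      by (rule order_trans[OF degree_smult_le degree_mult_le])
    also have "\<dots> < degree p + degree b"
      using False assms(1) degree_pderiv[of b] by linarith
    finally show ?thesis
      by (simp add: pb)
  qed
  then show ?thesis
    using pb by (simp add: eq degree_add_eq_right)
qed

text \<open>
  Each \<open>t\<close> in \<open>u\<close> raises the degree by \<open>deg p\<close>, which exceeds the degrees of all coefficients of
  \<open>u\<close>. The contributions of the different powers of \<open>t\<close> therefore have different degrees, and the
  highest power of \<open>t\<close> wins. The polynomial \<open>b\<close> is arbitrary because the induction on \<open>u\<close> peels off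
  factors \<open>t\<close> on the right and lets them act on \<open>b\<close>.
\<close>

lemma degree_triangular_action:
  fixes h :: "'k::field_char_0 poly"
  assumes \<rho>: "\<rho> \<in> ore_Aut h" "\<rho> ore_x = [:q:]" "\<rho> ore_t = [:p, [:\<gamma>:]:]"
    and q: "degree q = 1" and p: "degree h \<le> degree p" "\<And>j. degree (coeff u j) < degree p"
    and "u \<noteq> 0" "b \<noteq> 0"
  shows "degree (coeff (ore_mult h (\<rho> u) [:b:]) 0)
         = degree (lead_coeff u) + degree b + degree p * degree u"
  using p(2) assms(7,8)
proof (induction u arbitrary: b)
  case (pCons a u)
  have p0: "0 < degree p"
    using pCons.prems(1)[of 0] by simp
  have a: "degree (pcompose a q * b) \<le> degree a + degree b"
    using degree_mult_le[of "pcompose a q" b] by (simp add: degree_pcompose q)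
  have da: "degree a < degree p"
    using pCons.prems(1)[of 0] by simp
  have "\<rho> (pCons a u) = [:pcompose a q:] + ore_mult h (\<rho> u) (\<rho> ore_t)"
    using \<rho>(1) ore_Aut_pcompose[OF \<rho>(1,2)] by (simp only: pCons_eq_ore[of a u h] ore_Aut_iff)
  then have eq: "coeff (ore_mult h (\<rho> (pCons a u)) [:b:]) 0 = pcompose a q * b
      + coeff (ore_mult h (\<rho> u) [:coeff (ore_mult h (\<rho> ore_t) [:b:]) 0:]) 0"
    using coeff_ore_mult_0[of h "\<rho> u" "ore_mult h (\<rho> ore_t) [:b:]"]
    by (simp add: ore_mult_add_left ore_mult_assoc)
  show ?case
  proof (cases "u = 0")
    case True
    have "\<rho> 0 = 0"
      using ore_Aut_const[OF \<rho>(1), of 0] by simp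
    moreover have "pcompose a q \<noteq> 0"
      using True pCons.hyps q by (metis pcompose_eq_0_iff less_numeral_extra(1))
    ultimately show ?thesis
      using True pCons.prems q eq by (simp add: degree_mult_eq degree_pcompose)
  next
    case False
    let ?b = "coeff (ore_mult h (\<rho> ore_t) [:b:]) 0"
    have db: "degree ?b = degree p + degree b"
      using degree_triangular_t_action[OF p(1) p0 pCons.prems(3)] \<rho>(3) by simp
    have "degree (coeff (ore_mult h (\<rho> u) [:?b:]) 0)
        = degree (lead_coeff u) + degree ?b + degree p * degree u"
    proof (rule pCons.IH[OF _ False])
      show "degree (coeff u j) < degree p" for j
        using pCons.prems(1)[of "Suc j"] by simp
      show "?b \<noteq> 0"
        using db p0 by auto
    qed
    then have d: "degree (coeff (ore_mult h (\<rho> u) [:?b:]) 0)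
        = degree (lead_coeff u) + degree b + degree p * Suc (degree u)"
      by (simp add: db)
    then have "degree (pcompose a q * b) < degree (coeff (ore_mult h (\<rho> u) [:?b:]) 0)"
      using a da by simp
    then show ?thesis
      using False d by (simp add: eq degree_add_eq_right)
  qed
qed simp

lemma coeff_mult_at_degree_bounds:
  fixes a b :: "'a::comm_semiring_0 poly"
  assumes "degree a \<le> m" "degree b \<le> n"
  shows "coeff (a * b) (m + n) = coeff a m * coeff b n"
proof (cases "degree a = m \<and> degree b = n")
  case True
  then show ?thesis
    using coeff_mult_degree_sum[of a b] by auto
next
  case False
  then have "degree a + degree b < m + n"
    using assms by linarith
  then have "coeff (a * b) (m + n) = 0"
    using degree_mult_le[of a b] by (intro coeff_eq_0) linarith
  moreover have "coeff a m = 0 \<or> coeff b n = 0"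
    using False assms by (auto intro: coeff_eq_0)
  ultimately show ?thesis by auto
qed

section \<open>Derivations commuting with triangular automorphisms\<close>

context
  fixes h q p :: "'k::{alg_closed_field, field_char_0} poly" and \<gamma> :: 'k and D \<rho>
  assumes D: "ore_derivation h D" and iso: "\<rho> \<in> isotropy_group h D"
    and \<rho>x: "\<rho> ore_x = [:q:]" and \<rho>t: "\<rho> ore_t = [:p, [:\<gamma>:]:]"
    and q: "degree q = 1" and \<gamma>: "\<gamma> \<noteq> 0" and p: "degree h \<le> degree p"
begin

lemma isotropy_in_Aut: "\<rho> \<in> ore_Aut h" and isotropy_commute: "\<rho> (D u) = D (\<rho> u)"
  using iso by (auto simp: isotropy_group_def fun_eq_iff)

lemma coeff_ore_mult_one: "coeff (ore_mult h (\<rho> u) [:1:]) 0 = coeff (\<rho> u) 0"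
  by (simp flip: one_pCons)

text \<open>
  As \<open>\<rho> (D x)\<close> is a scalar multiple of \<open>D x\<close>, its \<open>t\<close>-free coefficient has degree below \<open>deg p\<close>. A
  positive power of \<open>t\<close> in \<open>D x\<close> would make that degree at least \<open>deg p\<close>.
\<close>

lemma isotropy_degree_Dx:
  assumes x: "\<And>j. degree (coeff (D ore_x) j) < degree p"
  shows "degree (D ore_x) = 0"
proof (rule ccontr)
  assume "degree (D ore_x) \<noteq> 0"
  then have "D ore_x \<noteq> 0" "degree p \<le> degree p * degree (D ore_x)"
    by auto
  then have "degree p \<le> degree (coeff (\<rho> (D ore_x)) 0)"
    using degree_triangular_action[OF isotropy_in_Aut \<rho>x \<rho>t q p x, of 1] coeff_ore_mult_one[of "D ore_x"]
    by (simp add: one_pCons trans_le_add2)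
  moreover have "q = [:coeff q 0, coeff q 1:]"
    using q by (intro poly_eqI) (auto simp: coeff_pCons coeff_eq_0 split: nat.split)
  then obtain a b where "q = [:b, a:]"
    by blast
  then have "\<rho> (D ore_x) = ore_scale a (D ore_x)"
    by (simp add: isotropy_commute \<rho>x ore_derivation_linear_poly[OF D])
  then have "degree (coeff (\<rho> (D ore_x)) 0) \<le> degree (coeff (D ore_x) 0)"
    by (simp add: ore_scale_def)
  ultimately show False
    using x[of 0] by linarith
qed

lemma isotropy_image_Dt:
  assumes "D ore_x = [:f:]"
  shows "\<rho> (D ore_t) = [:pderiv p * f:] + ore_scale \<gamma> (D ore_t)"
proof -
  have "\<rho> ore_t = [:p:] + ore_scale \<gamma> ore_t"
    unfolding \<rho>t by (simp add: ore_scale_def ore_t_def)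
  then show ?thesis
    by (simp only: isotropy_commute ore_derivation_add[OF D] ore_derivation_scale[OF D]
        ore_derivation_poly[OF D assms])
qed

text \<open>
  The same comparison for \<open>\<rho> (D t)\<close>: a power \<open>t\<^sup>2\<close> or higher in \<open>D t\<close> would give degree at least
  \<open>2 deg p\<close>, while \<open>p' f\<close> and \<open>D t\<close> itself stay below.
\<close>

lemma isotropy_degree_Dt:
  assumes Dx: "D ore_x = [:f:]" and f: "degree f < degree p"
    and t: "\<And>j. degree (coeff (D ore_t) j) < degree p"
  shows "degree (D ore_t) \<le> 1"
proof (rule ccontr)
  assume "\<not> degree (D ore_t) \<le> 1"
  then have "D ore_t \<noteq> 0" "2 \<le> degree (D ore_t)"
    by auto
  then have "degree p * 2 \<le> degree (coeff (\<rho> (D ore_t)) 0)"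
    using degree_triangular_action[OF isotropy_in_Aut \<rho>x \<rho>t q p t, of 1] coeff_ore_mult_one[of "D ore_t"]
    by (simp add: one_pCons trans_le_add2)
  moreover have "degree (coeff (\<rho> (D ore_t)) 0) \<le> degree p + degree f"
  proof -
    have "degree (pderiv p * f) \<le> degree p + degree f"
      using degree_mult_le[of "pderiv p" f] degree_pderiv[of p] by linarith
    moreover have "degree ([:\<gamma>:] * coeff (D ore_t) 0) \<le> degree p + degree f"
      using t[of 0] degree_smult_le[of \<gamma> "coeff (D ore_t) 0"] by simp
    ultimately show ?thesis
      unfolding isotropy_image_Dt[OF Dx] ore_scale_def
      by (simp add: degree_add_le)
  qed
  ultimately show False
    using f by linarith
qed

text \<open>
  The \<open>t\<close>-coefficient of \<open>\<rho> (D t) = p' f + \<gamma> (D t)\<close> says that \<open>g\<^sub>1\<close> is invariant under \<open>x \<mapsto> q\<close>, and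
  its \<open>t\<close>-free coefficient that \<open>p' f - g\<^sub>1 p\<close> has degree at most \<open>deg g\<^sub>0\<close>. Multiplying by \<open>x\<close>, so
  that \<open>x p'\<close> and \<open>p\<close> have the same degree, the top coefficients of the two products must cancel;
  that of \<open>x p'\<close> is \<open>deg p\<close> times that of \<open>p\<close>.
\<close>

lemma isotropy_top_coefficients:
  assumes Dx: "D ore_x = [:f:]" and Dt: "D ore_t = [:g0, g1:]"
    and "Suc (degree g0) < degree p" "degree f \<le> e" "degree (pCons 0 g1) \<le> e"
  shows "of_nat (degree p) * coeff f e = coeff (pCons 0 g1) e"
proof -
  have "[:g0, g1:] = [:g0:] + ore_mult h [:g1:] ore_t"
    by (simp add: ore_t_def)
  then have "\<rho> [:g0, g1:] = [:pcompose g0 q:] + ore_mult h [:pcompose g1 q:] (\<rho> ore_t)"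
    using isotropy_in_Aut ore_Aut_pcompose[OF isotropy_in_Aut \<rho>x] by (simp only: ore_Aut_iff)
  moreover have "\<rho> [:g0, g1:] = [:pderiv p * f:] + ore_scale \<gamma> [:g0, g1:]"
    using isotropy_image_Dt[OF Dx] by (simp only: Dt)
  ultimately have "[:pcompose g0 q + pcompose g1 q * p, smult \<gamma> (pcompose g1 q):]
      = [:pderiv p * f + smult \<gamma> g0, smult \<gamma> g1:]"
    by (simp add: \<rho>t ore_scale_def mult.commute)
  then have eq0: "pcompose g0 q + pcompose g1 q * p = pderiv p * f + smult \<gamma> g0"
    and "smult \<gamma> (pcompose g1 q) = smult \<gamma> g1"
    by auto
  then have "pcompose g1 q = g1"
    using \<gamma> by (metis smult_eq_iff)
  with eq0 have "pderiv p * f - g1 * p = pcompose g0 q - smult \<gamma> g0"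
    by (simp add: algebra_simps)
  then have "pCons 0 (pderiv p * f - g1 * p) = pCons 0 (pcompose g0 q - smult \<gamma> g0)"
    by simp
  then have eq: "pCons 0 (pderiv p) * f - p * pCons 0 g1 = pCons 0 (pcompose g0 q - smult \<gamma> g0)"
    by (simp add: mult.commute)
  have "degree (pcompose g0 q - smult \<gamma> g0) \<le> degree g0"
    using q by (intro degree_diff_le) (auto simp: degree_pcompose)
  then have "degree (pCons 0 (pcompose g0 q - smult \<gamma> g0)) < degree p + e"
    using assms(3) degree_pCons_le[of 0 "pcompose g0 q - smult \<gamma> g0"] by linarith
  then have "coeff (pCons 0 (pderiv p) * f) (degree p + e) = coeff (p * pCons 0 g1) (degree p + e)"
    by (metis eq coeff_diff coeff_eq_0 right_minus_eq)
  moreover have "degree (pCons 0 (pderiv p)) \<le> degree p"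
    using assms(3) degree_pCons_le[of 0 "pderiv p"] degree_pderiv[of p] by linarith
  ultimately have "coeff (pCons 0 (pderiv p)) (degree p) * coeff f e
      = lead_coeff p * coeff (pCons 0 g1) e"
    using assms(4,5) by (simp only: coeff_mult_at_degree_bounds order_refl)
  moreover have "coeff (pCons 0 (pderiv p)) (degree p) = of_nat (degree p) * lead_coeff p"
    using assms(3) by (cases "degree p") (simp_all add: coeff_pderiv)
  moreover have "lead_coeff p \<noteq> 0"
    using assms(3) by auto
  ultimately show ?thesis
    by simp
qed

end

lemma ex_coeff_degree_bound: "\<exists>B. \<forall>j. degree (coeff u j) < B"
proof -
  have "degree (coeff u j) < Suc (\<Sum>j\<le>degree u. degree (coeff u j))" for j
  proof (cases "j \<le> degree u")
    case True
    then show ?thesis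
      using member_le_sum[of j "{..degree u}" "\<lambda>j. degree (coeff u j)"] by simp
  qed (simp add: coeff_eq_0)
  then show ?thesis by blast
qed

text \<open>
  Two automorphisms with \<open>deg p\<close> beyond all bounds set by \<open>D x\<close> and \<open>D t\<close>, but with different
  \<open>deg p\<close>, already suffice: their top-coefficient equations differ only in the factor \<open>deg p\<close>.
\<close>

lemma derivation_triangular_if_isotropy_large:
  fixes h :: "'k::{alg_closed_field, field_char_0} poly"
  assumes D: "ore_derivation h D" and h: "degree h > 0"
    and large: "\<And>d. d \<ge> 1 \<Longrightarrow> \<exists>\<rho>\<in>isotropy_group h D. aut_deg \<rho> \<ge> ereal (real d)"
  obtains g where "D ore_x = 0" "D ore_t = [:g:]"
proof -
  have ex: "\<exists>\<rho> q p \<gamma>. \<rho> \<in> isotropy_group h D \<and> \<rho> ore_x = [:q:] \<and> \<rho> ore_t = [:p, [:\<gamma>:]:] \<and>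
      degree q = 1 \<and> \<gamma> \<noteq> 0 \<and> M \<le> degree p" for M
  proof -
    \<comment> \<open>A degree above 1 cannot come from \<open>\<rho> x\<close> or from the term \<open>\<gamma> t\<close>.\<close>
    obtain \<rho> where \<rho>: "\<rho> \<in> isotropy_group h D" "aut_deg \<rho> \<ge> ereal (real (M + 2))"
      using large[of "M + 2"] by auto
    have "\<rho> \<in> ore_Aut h"
      using \<rho>(1) by (simp add: isotropy_group_def)
    then obtain q p \<gamma> where t: "degree q = 1" "\<gamma> \<noteq> 0" "\<rho> ore_x = [:q:]" "\<rho> ore_t = [:p, [:\<gamma>:]:]"
      using ore_Aut_triangular[OF _ h] by blast
    then have "M + 2 \<le> degree p"
      by (intro aut_deg_triangular[OF \<rho>(2)]) auto
    then show ?thesis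
      using \<rho>(1) t by (metis add_leD1)
  qed
  obtain B1 B2 where B1: "degree (coeff (D ore_x) j) < B1" and B2: "degree (coeff (D ore_t) j) < B2" for j
    by (meson ex_coeff_degree_bound)
  \<comment> \<open>The successor leaves room for the factor \<open>x\<close> in the comparison of top coefficients.\<close>
  define B where "B = Suc (degree h + B1 + B2)"
  obtain \<rho> q p \<gamma> where r: "\<rho> \<in> isotropy_group h D" "\<rho> ore_x = [:q:]" "\<rho> ore_t = [:p, [:\<gamma>:]:]"
      "degree q = 1" "\<gamma> \<noteq> 0" and B: "B \<le> degree p"
    using ex by blast
  obtain \<rho>' q' p' \<gamma>' where r': "\<rho>' \<in> isotropy_group h D" "\<rho>' ore_x = [:q':]"
      "\<rho>' ore_t = [:p', [:\<gamma>':]:]" "degree q' = 1" "\<gamma>' \<noteq> 0" and B': "Suc (degree p) \<le> degree p'"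
    using ex by blast
  have hp: "degree h \<le> degree p" "degree h \<le> degree p'"
    using B B' by (auto simp: B_def)
  note iso = D r hp(1) and iso' = D r' hp(2)
  have x: "degree (coeff (D ore_x) j) < degree p" and t: "Suc (degree (coeff (D ore_t) j)) < degree p" for j
    using B1[of j] B2[of j] B by (auto simp: B_def)
  obtain f where f: "D ore_x = [:f:]"
    using isotropy_degree_Dx[OF iso x] by (meson degree_eq_zeroE)
  have "degree (D ore_t) \<le> 1"
    using x[of 0] Suc_lessD[OF t] by (intro isotropy_degree_Dt[OF iso f]) (auto simp: f)
  then have "\<exists>g0 g1. D ore_t = [:g0, g1:]"
    by (intro exI[of _ "coeff (D ore_t) 0"] exI[of _ "coeff (D ore_t) 1"] poly_eqI)
      (auto simp: coeff_pCons coeff_eq_0 split: nat.split)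
  then obtain g0 g1 where g: "D ore_t = [:g0, g1:]"
    by blast
  define e where "e = max (degree f) (degree (pCons 0 g1))"
  have g0: "Suc (degree g0) < degree p" "Suc (degree g0) < degree p'"
    using t[of 0] B' by (auto simp: g)
  have "of_nat (degree p) * coeff f e = coeff (pCons 0 g1) e"
    by (rule isotropy_top_coefficients[OF iso f g g0(1)]) (simp_all add: e_def)
  moreover have "of_nat (degree p') * coeff f e = coeff (pCons 0 g1) e"
    by (rule isotropy_top_coefficients[OF iso' f g g0(2)]) (simp_all add: e_def)
  moreover have "of_nat (degree p) \<noteq> (of_nat (degree p') :: 'k)"
    using B' by (simp only: of_nat_eq_iff)
  ultimately have zero: "coeff f e = 0"
    by (metis mult_cancel_right)
  then have zero': "coeff (pCons 0 g1) e = 0"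
    using \<open>of_nat (degree p) * coeff f e = coeff (pCons 0 g1) e\<close> by simp
  have "f = 0 \<and> pCons 0 g1 = 0"
  proof (cases "degree (pCons 0 g1) \<le> degree f")
    case True
    then have "e = degree f"
      by (simp add: e_def)
    then have "f = 0"
      using zero by simp
    then have "degree (pCons 0 g1) = e"
      using True by (simp add: e_def)
    then show ?thesis
      using \<open>f = 0\<close> zero' leading_coeff_0_iff by blast
  next
    case False
    then have "degree (pCons 0 g1) = e"
      by (simp add: e_def)
    then have "pCons 0 g1 = 0"
      using zero' leading_coeff_0_iff by blast
    then show ?thesis
      using False by simp
  qed
  then show ?thesis
    using that f g by simp
qed

theorem theorem22:
  fixes h :: "'k::{alg_closed_field, field_char_0} poly"
    and D :: "'k poly poly \<Rightarrow> 'k poly poly"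
  assumes "h \<notin> range (\<lambda>c. [:c:])"
    and "ore_derivation h D"
  shows "locally_nilpotent D \<longleftrightarrow>
         (\<forall>d::int. d \<ge> 1 \<longrightarrow> (\<exists>\<rho>\<in>isotropy_group h D. aut_deg \<rho> \<ge> ereal (real_of_int d)))"
proof
  have h: "degree h > 0"
    using assms(1) by (metis degree_eq_zeroE gr0I rangeI)
  show "\<forall>d::int. d \<ge> 1 \<longrightarrow> (\<exists>\<rho>\<in>isotropy_group h D. aut_deg \<rho> \<ge> ereal (real_of_int d))"
    if lnd: "locally_nilpotent D"
  proof (intro allI impI)
    fix d :: int
    assume "d \<ge> 1"
    then obtain n where n: "d = int n"
      by (metis nonneg_int_cases zero_le_one order_trans)
    obtain g where g: "D ore_x = 0" "D ore_t = [:g:]"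
      using lnd_triangular[OF assms(2) lnd h] .
    let ?\<rho> = "ore_shear h (monom 1 n)"
    have "ereal (real n) \<le> total_deg (?\<rho> ore_t)"
      unfolding le_total_deg_iff ore_shear_t by (intro exI[of _ n] exI[of _ 0]) simp
    then have "ereal (real_of_int d) \<le> aut_deg ?\<rho>"
      by (simp add: aut_deg_def n le_max_iff_disj)
    then show "\<exists>\<rho>\<in>isotropy_group h D. aut_deg \<rho> \<ge> ereal (real_of_int d)"
      using ore_shear_in_isotropy_group[OF assms(2) g] by blast
  qed
  show "locally_nilpotent D"
    if large: "\<forall>d::int. d \<ge> 1 \<longrightarrow> (\<exists>\<rho>\<in>isotropy_group h D. aut_deg \<rho> \<ge> ereal (real_of_int d))"
  proof -
    have "\<exists>\<rho>\<in>isotropy_group h D. aut_deg \<rho> \<ge> ereal (real d)" if "d \<ge> 1" for d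
      using large[rule_format, of "int d"] that by simp
    then obtain g where "D ore_x = 0" "D ore_t = [:g:]"
      using derivation_triangular_if_isotropy_large[OF assms(2) h] by metis
    then show ?thesis
      by (rule locally_nilpotentI[OF assms(2)])
  qed
qed

end
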